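(* The positional marked patterns $1\underline{2}34$ and $1\underline{2}43$ are $pmp$-Wilf equivalent; that is, for every $n\ge1$, $\sum_{\sigma\in S_n}x^{pmp_{1\underline{2}34}(\sigma)}=\sum_{\sigma\in S_n}x^{pmp_{1\underline{2}43}(\sigma)}$.
   Context: A positional marked pattern of length $k$ is a permutation $\tau$ of $[k]$ with exactly one entry underlined; $\pi(\tau)$ is the permutation obtained by removing the underline and $u(\tau)$ is the position of the underlined entry. For a word $w$ with distinct letters, $red(w)$ replaces the $i$-th smallest letter by $i$. For $\sigma\in S_n$, $\sigma$ has a $\tau$-match at position $\ell$ if there are indices $i_1<\cdots<i_k$ with $i_{u(\tau)}=\ell$ and $red(\sigma_{i_1}\cdots\sigma_{i_k})=\pi(\tau)$; $pmp_\tau(\sigma)$ is the number of such positions. Here $1\underline{2}34$ has $\pi=1234$, $u=2$, and $1\underline{2}43$ has $\pi=1243$, $u=2$. *)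

theory Defs
  imports
    "HOL-Combinatorics.Multiset_Permutations"
    "HOL-Computational_Algebra.Polynomial"
begin

text \<open>
  Permutations are words in one-line notation: an element of \<open>S\<^sub>n\<close> is a list in
  \<open>permutations_of_set {1..n}\<close>. Positions are counted from 1, hence the shift by one
  relative to list indexing.
\<close>

datatype marked_pattern = Marked_Pattern (pat_perm: "nat list") (pat_pos: nat)

definition is_marked_pattern :: "marked_pattern \<Rightarrow> bool" where
  "is_marked_pattern \<tau> \<longleftrightarrow>
     pat_perm \<tau> \<in> permutations_of_set {1..length (pat_perm \<tau>)} \<and>
     pat_pos \<tau> \<in> {1..length (pat_perm \<tau>)}"

definition letter :: "nat list \<Rightarrow> nat \<Rightarrow> nat" where
  "letter w i = w ! (i - 1)"

definition red :: "nat list \<Rightarrow> nat list" where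
  "red w = map (\<lambda>a. card {b \<in> set w. b \<le> a}) w"

definition match_at :: "marked_pattern \<Rightarrow> nat list \<Rightarrow> nat \<Rightarrow> bool" where
  "match_at \<tau> \<sigma> l \<longleftrightarrow>
     (\<exists>is. length is = length (pat_perm \<tau>) \<and> set is \<subseteq> {1..length \<sigma>} \<and> sorted_wrt (<) is \<and>
        letter is (pat_pos \<tau>) = l \<and> red (map (letter \<sigma>) is) = pat_perm \<tau>)"

definition pmp :: "marked_pattern \<Rightarrow> nat list \<Rightarrow> nat" where
  "pmp \<tau> \<sigma> = card {l \<in> {1..length \<sigma>}. match_at \<tau> \<sigma> l}"

definition pmp_poly :: "marked_pattern \<Rightarrow> nat \<Rightarrow> int poly" where
  "pmp_poly \<tau> n = (\<Sum>\<sigma>\<in>permutations_of_set {1..n}. monom 1 (pmp \<tau> \<sigma>))"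

definition pmp_Wilf_equivalent :: "marked_pattern \<Rightarrow> marked_pattern \<Rightarrow> bool" where
  "pmp_Wilf_equivalent \<tau> \<tau>' \<longleftrightarrow>
     is_marked_pattern \<tau> \<and> is_marked_pattern \<tau>' \<and> (\<forall>n\<ge>1. pmp_poly \<tau> n = pmp_poly \<tau>' n)"

end

theory Submission
  imports Defs
begin

text \<open>
  Position \<open>l\<close> matches \<open>1234\<close> (marked at \<open>2\<close>) iff \<open>\<sigma>\<^sub>l\<close> is not a left-to-right minimum and the
  larger letters to its right are not decreasing; for \<open>1243\<close> replace decreasing by increasing.
  Delete the first letter \<open>a\<close> repeatedly, remembering the minimum \<open>m\<close> of the deleted letters. Besides
  the number of matches, keep track of the largest \<open>t\<close> such that the \<open>t\<close> largest letters form
  a decreasing (increasing) subsequence, capped at the number \<open>h\<close> of letters above \<open>m\<close>.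
  Let \<open>k\<close> be the number of remaining letters above \<open>a\<close>. If \<open>k \<ge> h\<close>, then \<open>a\<close> is the new minimum. If \<open>t < k < h\<close>,
  there is a match at \<open>a\<close> and \<open>t\<close> is unchanged. If \<open>k \<le> t\<close>, there is no match, and the new
  value of \<open>t\<close> is \<open>k + 1\<close> in the increasing case, while in the decreasing case it is \<open>t + 1\<close> for
  \<open>k = 0\<close> and \<open>k\<close> otherwise. As \<open>k\<close> varies, both rules yield the same multiset of new values, so the
  joint distributions obey the same recursion.
\<close>

section \<open>The recursion for the joint distribution\<close>

text \<open>\<open>m\<close> stands for the least letter already deleted: a letter
  \<open>a \<le> m\<close> has no smaller letter before it and only updates this minimum.
  \<open>Q\<close> is the order that the larger letters must violate to give a match.\<close>

fun match_count :: "(nat \<Rightarrow> nat \<Rightarrow> bool) \<Rightarrow> nat \<Rightarrow> nat list \<Rightarrow> nat" where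
  "match_count Q m [] = 0"
| "match_count Q m (a # w) =
    (if a \<le> m then match_count Q a w
     else (if sorted_wrt Q (filter (\<lambda>x. a < x) w) then 0 else 1) + match_count Q m w)"

text \<open>Encodes \<open>t\<close> as the cardinality of an upper set of letters, so that
  inclusions can replace counting; the condition \<open>m < b\<close> is the cap at
  \<open>h\<close>.\<close>

definition sorted_top :: "(nat \<Rightarrow> nat \<Rightarrow> bool) \<Rightarrow> nat \<Rightarrow> nat list \<Rightarrow> nat set" where
  "sorted_top Q m w = {b \<in> set w. m < b \<and> sorted_wrt Q (filter (\<lambda>x. b \<le> x) w)}"

text \<open>A joint distribution is given by its sums against arbitrary test functions
  \<open>g\<close> of the match count and \<open>t\<close>; prepending a letter acts on
  \<open>g\<close>. The index \<open>k\<close> counts the letters above the prepended one, and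
  \<open>Suc k\<close> is the increasing rule.\<close>

fun distr :: "nat \<Rightarrow> nat \<Rightarrow> (nat \<Rightarrow> nat \<Rightarrow> 'a::comm_monoid_add) \<Rightarrow> 'a" where
  "distr 0 h g = g 0 0"
| "distr (Suc n) h g =
    (\<Sum>k=h..n. distr n k (\<lambda>c t. g c (min h t))) +
    distr n (h - 1) (\<lambda>c t. \<Sum>k<h. if t < k then g (Suc c) t else g c (Suc k))"

text \<open>Additivity lets the sum over \<open>k\<close> move inside \<open>distr\<close>, where
  \<open>c\<close> and \<open>t\<close> are fixed and two update rules can be compared.\<close>

lemma distr_sum: "distr n h (\<lambda>c t. \<Sum>k\<in>K. G k c t) = (\<Sum>k\<in>K. distr n h (G k))"
proof (induction n arbitrary: h G)
  case (Suc n)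
  have inner: "(\<Sum>k<h. if t < k then \<Sum>i\<in>K. G i (Suc c) t else \<Sum>i\<in>K. G i c (Suc k)) =
    (\<Sum>i\<in>K. \<Sum>k<h. if t < k then G i (Suc c) t else G i c (Suc k))" for c t
    by (subst sum.swap) (auto intro!: sum.cong)
  show ?case
    by (simp add: inner Suc.IH sum.distrib) (rule arg_cong2[where f = "(+)", OF sum.swap refl])
qed simp

section \<open>Sorted largest letters after prepending a letter\<close>

lemma sorted_wrt_filter_iff:
  "sorted_wrt Q (filter P xs) \<longleftrightarrow> sorted_wrt (\<lambda>x y. P x \<longrightarrow> P y \<longrightarrow> Q x y) xs"
  by (induction xs) auto

lemma sorted_wrt_filter_mono:
  assumes "sorted_wrt Q (filter P xs)" "\<And>x. x \<in> set xs \<Longrightarrow> P' x \<Longrightarrow> P x"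
  shows "sorted_wrt Q (filter P' xs)"
  using assms by (induction xs) (auto split: if_splits)

lemma finite_sorted_top [simp]: "finite (sorted_top Q m w)"
  by (simp add: sorted_top_def)

lemma sorted_top_upward:
  assumes "b \<in> sorted_top Q m w" "c \<in> set w" "b \<le> c"
  shows "c \<in> sorted_top Q m w"
  using assms sorted_wrt_filter_mono[of Q "\<lambda>x. b \<le> x" w "\<lambda>x. c \<le> x"]
  by (auto simp: sorted_top_def)

text \<open>If each set had an element outside the other, the smaller of the two would force the
  larger into its own set.\<close>

lemma upward_closed_nested:
  fixes X :: "nat set"
  assumes "A \<subseteq> X" "B \<subseteq> X"
    and "\<And>b c. b \<in> A \<Longrightarrow> c \<in> X \<Longrightarrow> b \<le> c \<Longrightarrow> c \<in> A"
    and "\<And>b c. b \<in> B \<Longrightarrow> c \<in> X \<Longrightarrow> b \<le> c \<Longrightarrow> c \<in> B"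
  shows "A \<subseteq> B \<or> B \<subseteq> A"
  using assms by (meson nat_le_linear subset_iff)

lemma sorted_top_nested:
  "{b \<in> set w. a < b} \<subseteq> sorted_top Q m w \<or> sorted_top Q m w \<subseteq> {b \<in> set w. a < b}"
proof (rule upward_closed_nested[where X = "set w"])
  show "sorted_top Q m w \<subseteq> set w" by (auto simp: sorted_top_def)
qed (auto intro: sorted_top_upward)

text \<open>Letters above \<open>m\<close> ignore \<open>a\<close>, so only the cap changes: the
  result is an intersection of two nested sets.\<close>

lemma card_sorted_top_Cons_le:
  assumes "a \<le> m"
  shows "card (sorted_top Q m (a # w)) = min (card {b \<in> set w. m < b}) (card (sorted_top Q a w))"
proof -
  have "sorted_top Q m (a # w) = {b \<in> set w. m < b} \<inter> sorted_top Q a w"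
    using assms by (auto simp: sorted_top_def)
  moreover consider "{b \<in> set w. m < b} \<subseteq> sorted_top Q a w"
    | "sorted_top Q a w \<subseteq> {b \<in> set w. m < b}"
    using sorted_top_nested by blast
  then have "card ({b \<in> set w. m < b} \<inter> sorted_top Q a w) =
    min (card {b \<in> set w. m < b}) (card (sorted_top Q a w))"
  proof cases
    case 1
    then have "card {b \<in> set w. m < b} \<le> card (sorted_top Q a w)" by (intro card_mono) auto
    with 1 show ?thesis by (simp add: Int_absorb2)
  next
    case 2
    then have "card (sorted_top Q a w) \<le> card {b \<in> set w. m < b}" by (intro card_mono) auto
    with 2 show ?thesis by (simp add: Int_absorb1)
  qed
  ultimately show ?thesis by simp
qed

lemma sorted_top_upper_iff:
  assumes "m < a"
  shows "{b \<in> set w. a < b} \<subseteq> sorted_top Q m w \<longleftrightarrow> sorted_wrt Q (filter (\<lambda>x. a < x) w)"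
    (is "?U \<subseteq> _ \<longleftrightarrow> _")
proof
  assume sub: "?U \<subseteq> sorted_top Q m w"
  show "sorted_wrt Q (filter (\<lambda>x. a < x) w)"
  proof (cases "?U = {}")
    case True
    then have "filter (\<lambda>x. a < x) w = []"
      by (auto simp: filter_empty_conv)
    then show ?thesis by simp
  next
    case False
    \<comment> \<open>The least letter above \<open>a\<close> tests them all: its membership says
      that the letters from it upwards are sorted.\<close>
    then have "Min ?U \<in> ?U" by (intro Min_in) auto
    then have "sorted_wrt Q (filter (\<lambda>x. Min ?U \<le> x) w)"
      using sub by (auto simp: sorted_top_def)
    then show ?thesis
      by (rule sorted_wrt_filter_mono) (auto intro!: Min_le)
  qed
next
  assume "sorted_wrt Q (filter (\<lambda>x. a < x) w)"
  then show "?U \<subseteq> sorted_top Q m w"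
    using assms by (auto simp: sorted_top_def intro: sorted_wrt_filter_mono)
qed

text \<open>By nestedness, comparing cardinalities decides inclusion. Thus \<open>t\<close> and
  \<open>k\<close> alone reveal whether there is a match at \<open>a\<close>.\<close>

lemma card_sorted_top_less_iff:
  assumes "m < a"
  shows "card (sorted_top Q m w) < card {b \<in> set w. a < b} \<longleftrightarrow>
    \<not> sorted_wrt Q (filter (\<lambda>x. a < x) w)"
  using sorted_top_nested[of w a Q m] sorted_top_upper_iff[OF assms, of w Q]
    card_mono[of "sorted_top Q m w" "{b \<in> set w. a < b}"]
    psubset_card_mono[of "{b \<in> set w. a < b}" "sorted_top Q m w"]
  by (auto simp: not_less[symmetric])

lemma sorted_top_Cons_unsorted:
  assumes "m < a" "a \<notin> set w" "\<not> sorted_wrt Q (filter (\<lambda>x. a < x) w)"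
  shows "sorted_top Q m (a # w) = sorted_top Q m w"
proof -
  have sub: "sorted_top Q m w \<subseteq> {b \<in> set w. a < b}"
    using sorted_top_nested[of w a Q m] sorted_top_upper_iff[OF assms(1), of w Q] assms(3) by auto
  have "\<not> sorted_wrt Q (filter (\<lambda>x. b \<le> x) w)" if "b \<le> a" for b
    using assms(3) that sorted_wrt_filter_mono[of Q "\<lambda>x. b \<le> x" w "\<lambda>x. a < x"] by auto
  with sub show ?thesis
    by (fastforce simp: sorted_top_def split: if_splits)
qed

text \<open>In front of larger increasing letters \<open>a\<close> extends them, while a smaller
  letter behind \<open>a\<close> breaks the increase: exactly the letters from \<open>a\<close>
  upwards remain.\<close>

lemma card_sorted_top_Cons_less:
  assumes "m < a" "a \<notin> set w" "sorted_wrt (<) (filter (\<lambda>x. a < x) w)"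
  shows "card (sorted_top (<) m (a # w)) = Suc (card {b \<in> set w. a < b})"
proof -
  have sub: "{b \<in> set w. a < b} \<subseteq> sorted_top (<) m w"
    using sorted_top_upper_iff[OF assms(1)] assms(3) by blast
  have eq: "filter (\<lambda>x. a \<le> x) w = filter (\<lambda>x. a < x) w"
    using assms(2) by (intro filter_cong) (auto simp: le_less)
  have "sorted_top (<) m (a # w) = insert a {b \<in> set w. a < b}"
    using sub assms eq by (fastforce simp: sorted_top_def split: if_splits)
  then show ?thesis by simp
qed

text \<open>In front of a larger letter \<open>a\<close> breaks the decrease, so only the letters
  above \<open>a\<close> remain; a largest \<open>a\<close> extends any decreasing subsequence and
  joins the old top.\<close>

lemma card_sorted_top_Cons_greater:
  assumes "m < a" "a \<notin> set w" "sorted_wrt (>) (filter (\<lambda>x. a < x) w)"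
  shows "card (sorted_top (>) m (a # w)) =
    (if {b \<in> set w. a < b} = {} then Suc (card (sorted_top (>) m w)) else card {b \<in> set w. a < b})"
proof (cases "{b \<in> set w. a < b} = {}")
  case True
  then have all: "\<forall>b\<in>set w. b < a"
    using assms(2) by (auto simp: not_less le_less)
  then have eq: "filter (\<lambda>x. a \<le> x) w = []"
    by (auto simp: filter_empty_conv)
  have "sorted_top (>) m (a # w) = insert a (sorted_top (>) m w)"
    using all eq assms(1) by (auto simp: sorted_top_def)
  moreover have "a \<notin> sorted_top (>) m w"
    using assms(2) by (auto simp: sorted_top_def)
  ultimately show ?thesis using True by simp
next
  case False
  have sub: "{b \<in> set w. a < b} \<subseteq> sorted_top (>) m w"
    using sorted_top_upper_iff[OF assms(1)] assms(3) by blast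
  obtain c where c: "c \<in> set w" "a < c" using False by auto
  have "sorted_top (>) m (a # w) = {b \<in> set w. a < b}"
  proof (intro equalityI subsetI)
    fix b assume b: "b \<in> sorted_top (>) m (a # w)"
    have "\<not> b \<le> a"
    proof
      assume "b \<le> a"
      then have "\<forall>x\<in>set w. b \<le> x \<longrightarrow> x < a"
        using b by (auto simp: sorted_top_def)
      with c \<open>b \<le> a\<close> show False by force
    qed
    with b show "b \<in> {b \<in> set w. a < b}"
      by (auto simp: sorted_top_def)
  next
    fix b assume "b \<in> {b \<in> set w. a < b}"
    with sub assms(1) show "b \<in> sorted_top (>) m (a # w)"
      by (auto simp: sorted_top_def)
  qed
  then show ?thesis unfolding if_not_P[OF False] by simp
qed

section \<open>Summation over the first letter by its rank\<close>

lemma bij_betw_card_greater: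
  fixes S :: "nat set"
  assumes "finite S"
  shows "bij_betw (\<lambda>a. card {b \<in> S. a < b}) S {..<card S}"
proof -
  have less: "card {c \<in> S. b < c} < card {c \<in> S. a < c}" if "a < b" "b \<in> S" for a b
  proof -
    have "card (insert b {c \<in> S. b < c}) \<le> card {c \<in> S. a < c}"
      using assms that by (intro card_mono) auto
    then show ?thesis using assms by simp
  qed
  have inj: "inj_on (\<lambda>a. card {b \<in> S. a < b}) S"
    by (rule linorder_inj_onI) (use less in fastforce)+
  have "card {b \<in> S. a < b} < card S" if "a \<in> S" for a
  proof -
    have "card (insert a {b \<in> S. a < b}) \<le> card S"
      using assms that by (intro card_mono) auto
    then show ?thesis using assms by simp
  qed
  then have "(\<lambda>a. card {b \<in> S. a < b}) ` S = {..<card S}"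
    by (intro card_subset_eq) (auto simp: card_image[OF inj])
  with inj show ?thesis by (simp add: bij_betw_def)
qed

lemma sum_permutations_of_set_Cons:
  assumes "finite S" "S \<noteq> {}"
  shows "(\<Sum>w\<in>permutations_of_set S. f w) =
    (\<Sum>a\<in>S. \<Sum>w\<in>permutations_of_set (S - {a}). f (a # w))"
proof -
  have "(\<Sum>w\<in>permutations_of_set S. f w) =
    (\<Sum>a\<in>S. \<Sum>w\<in>(#) a ` permutations_of_set (S - {a}). f w)"
    unfolding permutations_of_set_nonempty[OF assms(2)]
    using assms(1) by (intro sum.UNION_disjoint) auto
  also have "\<dots> = (\<Sum>a\<in>S. \<Sum>w\<in>permutations_of_set (S - {a}). f (a # w))"
    by (rule sum.cong[OF refl], subst sum.reindex) (auto simp: inj_on_def)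
  finally show ?thesis .
qed

text \<open>Treats both orders at once: \<open>next_top\<close> updates \<open>t\<close> when the
  letters above \<open>a\<close> are sorted, and \<open>rearrange\<close> asks that, summed over
  \<open>k\<close>, it agree with the increasing rule built into \<open>distr\<close>.\<close>

lemma joint_distribution:
  fixes g :: "nat \<Rightarrow> nat \<Rightarrow> 'a::comm_monoid_add"
    and next_top :: "nat \<Rightarrow> nat \<Rightarrow> nat \<Rightarrow> nat"
  assumes "finite S"
    and next_top: "\<And>m a w. m < a \<Longrightarrow> distinct (a # w) \<Longrightarrow> sorted_wrt Q (filter (\<lambda>x. a < x) w) \<Longrightarrow>
      card (sorted_top Q m (a # w)) = next_top (Suc (card {b \<in> set w. m < b}))
        (card (sorted_top Q m w)) (card {b \<in> set w. a < b})"
    and rearrange: "\<And>h c t (g :: nat \<Rightarrow> nat \<Rightarrow> 'a).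
      (\<Sum>k<h. if t < k then g (Suc c) t else g c (next_top h t k)) =
      (\<Sum>k<h. if t < k then g (Suc c) t else g c (Suc k))"
  shows "(\<Sum>w\<in>permutations_of_set S. g (match_count Q m w) (card (sorted_top Q m w))) =
    distr (card S) (card {b \<in> S. m < b}) g"
  using \<open>finite S\<close>
proof (induction "card S" arbitrary: S m g)
  case 0
  then show ?case by (simp add: sorted_top_def)
next
  case (Suc n)
  define h where "h = card {b \<in> S. m < b}"
  define rank where "rank a = card {b \<in> S. a < b}" for a
  define f where "f w = g (match_count Q m w) (card (sorted_top Q m w))" for w
  \<comment> \<open>The total over words whose first letter has \<open>k\<close> larger letters in
    \<open>S\<close>; \<open>h \<le> k\<close> means that this letter is at most
    \<open>m\<close>.\<close>
  define contrib where "contrib k = (if h \<le> k then distr n k (\<lambda>c t. g c (min h t))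
    else distr n (h - 1) (\<lambda>c t. if t < k then g (Suc c) t else g c (next_top h t k)))" for k
  have "h \<le> Suc n"
    unfolding h_def Suc.hyps(2) using Suc.prems by (intro card_mono) auto
  have step: "(\<Sum>w\<in>permutations_of_set (S - {a}). f (a # w)) = contrib (rank a)" if "a \<in> S" for a
  proof -
    have card_a: "n = card (S - {a})" using Suc.hyps(2) that Suc.prems by simp
    have rank_a: "card {b \<in> S - {a}. a < b} = rank a"
      unfolding rank_def by (rule arg_cong[where f = card]) auto
    have in_perm: "set w = S - {a}" "a \<notin> set w" "distinct w"
      if "w \<in> permutations_of_set (S - {a})" for w
      using that by (auto simp: permutations_of_set_def)
    show ?thesis
    proof (cases "a \<le> m")
      case True
      have "h \<le> rank a"
        unfolding h_def rank_def using True Suc.prems by (intro card_mono) auto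
      have "{b \<in> S - {a}. m < b} = {b \<in> S. m < b}" using True by auto
      then have "f (a # w) = g (match_count Q a w) (min h (card (sorted_top Q a w)))"
        if "w \<in> permutations_of_set (S - {a})" for w
        using True in_perm[OF that] by (simp add: f_def card_sorted_top_Cons_le h_def)
      then have "(\<Sum>w\<in>permutations_of_set (S - {a}). f (a # w)) =
        (\<Sum>w\<in>permutations_of_set (S - {a}).
          (\<lambda>c t. g c (min h t)) (match_count Q a w) (card (sorted_top Q a w)))"
        by (intro sum.cong) auto
      also have "\<dots> = distr n (rank a) (\<lambda>c t. g c (min h t))"
        using Suc.hyps(1)[OF card_a, where m = a and g = "\<lambda>c t. g c (min h t)"] Suc.prems
        unfolding card_a[symmetric] rank_a by simp
      finally show ?thesis using \<open>h \<le> rank a\<close> by (simp add: contrib_def)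
    next
      case False
      have "card (insert a {b \<in> S. a < b}) \<le> h"
        unfolding h_def using False that Suc.prems by (intro card_mono) auto
      then have "rank a < h"
        using Suc.prems by (simp add: rank_def)
      have "{b \<in> S - {a}. m < b} = {b \<in> S. m < b} - {a}" by auto
      then have h': "card {b \<in> S - {a}. m < b} = h - 1"
        using False that Suc.prems by (simp add: h_def)
      let ?G = "\<lambda>c t. if t < rank a then g (Suc c) t else g c (next_top h t (rank a))"
      have "f (a # w) = ?G (match_count Q m w) (card (sorted_top Q m w))"
        if "w \<in> permutations_of_set (S - {a})" for w
      proof -
        note w = in_perm[OF that]
        have less: "card (sorted_top Q m w) < rank a \<longleftrightarrow> \<not> sorted_wrt Q (filter (\<lambda>x. a < x) w)"
          using card_sorted_top_less_iff[of m a Q w] False w rank_a by simp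
        show ?thesis
        proof (cases "sorted_wrt Q (filter (\<lambda>x. a < x) w)")
          case True
          then show ?thesis
            using False w less next_top[of m a w] h' rank_a \<open>rank a < h\<close> by (simp add: f_def)
        next
          case unsorted: False
          then show ?thesis
            using False w less sorted_top_Cons_unsorted[of m a w Q] by (simp add: f_def)
        qed
      qed
      then have "(\<Sum>w\<in>permutations_of_set (S - {a}). f (a # w)) =
        (\<Sum>w\<in>permutations_of_set (S - {a}). ?G (match_count Q m w) (card (sorted_top Q m w)))"
        by (intro sum.cong) auto
      also have "\<dots> = distr n (h - 1) ?G"
        using Suc.hyps(1)[OF card_a, where m = m and g = ?G] Suc.prems
        unfolding card_a[symmetric] h' by simp
      finally show ?thesis using \<open>rank a < h\<close> by (simp add: contrib_def)
    qed
  qed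
  have "(\<Sum>w\<in>permutations_of_set S. f w) = (\<Sum>a\<in>S. contrib (rank a))"
    using Suc step by (subst sum_permutations_of_set_Cons) auto
  also have "\<dots> = (\<Sum>k<Suc n. contrib k)"
    using bij_betw_card_greater[OF Suc.prems] unfolding Suc.hyps(2) rank_def
    by (rule sum.reindex_bij_betw)
  also have "\<dots> = (\<Sum>k\<in>{h..n} \<union> {..<h}. contrib k)"
    using \<open>h \<le> Suc n\<close> by (intro sum.cong) auto
  also have "\<dots> = (\<Sum>k=h..n. contrib k) + (\<Sum>k<h. contrib k)"
    by (rule sum.union_disjoint) auto
  also have "(\<Sum>k<h. contrib k) =
    (\<Sum>k<h. distr n (h - 1) (\<lambda>c t. if t < k then g (Suc c) t else g c (next_top h t k)))"
    by (intro sum.cong) (auto simp: contrib_def)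
  \<comment> \<open>For \<open>h = 0\<close> the predecessor \<open>h - 1\<close> is truncated, but
    the sums over \<open>k\<close> are empty and both sides vanish.\<close>
  also have "\<dots> = distr n (h - 1) (\<lambda>c t. \<Sum>k<h. if t < k then g (Suc c) t else g c (Suc k))"
    by (simp add: distr_sum[symmetric] rearrange)
  also have "(\<Sum>k=h..n. contrib k) = (\<Sum>k=h..n. distr n k (\<lambda>c t. g c (min h t)))"
    by (intro sum.cong) (auto simp: contrib_def)
  finally show ?case
    by (simp add: f_def Suc.hyps(2)[symmetric] h_def)
qed

section \<open>Instances for the increasing and the decreasing order\<close>

lemma joint_distribution_less:
  fixes g :: "nat \<Rightarrow> nat \<Rightarrow> 'a::comm_monoid_add"
  assumes "finite S"
  shows "(\<Sum>w\<in>permutations_of_set S. g (match_count (<) m w) (card (sorted_top (<) m w))) =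
    distr (card S) (card {b \<in> S. m < b}) g"
  by (rule joint_distribution[where next_top = "\<lambda>h t k. Suc k"])
    (use assms in \<open>auto simp: card_sorted_top_Cons_less\<close>)

text \<open>On both sides the terms with \<open>k \<le> t\<close> run through the new values from
  \<open>1\<close> to \<open>min h (Suc t)\<close>; the left side merely puts the largest first. The
  cap by \<open>h\<close> makes this true for every \<open>t\<close>.\<close>

lemma sum_rotate:
  fixes g :: "nat \<Rightarrow> nat \<Rightarrow> 'a::comm_monoid_add"
  shows "(\<Sum>k<h. if t < k then g (Suc c) t else g c (if k = 0 then min h (Suc t) else k)) =
    (\<Sum>k<h. if t < k then g (Suc c) t else g c (Suc k))"
proof -
  let ?F = "\<lambda>k. if t < k then g (Suc c) t else g c k"
  let ?L = "\<lambda>h. \<Sum>k<h. if t < k then g (Suc c) t else g c (if k = 0 then min h (Suc t) else k)"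
  have L: "?L h = g c (min h (Suc t)) + (\<Sum>k=1..<h. ?F k)" if "h > 0" for h
  proof -
    have "{..<h} = insert 0 {1..<h}" using that by auto
    then show ?thesis by (simp cong: if_cong)
  qed
  show ?thesis
  proof (induction h)
    case (Suc h)
    show ?case
    proof (cases "h = 0")
      case False
      have "?L (Suc h) = g c (min (Suc h) (Suc t)) + ((\<Sum>k=1..<h. ?F k) + ?F h)"
        using False by (subst L) (auto simp: sum.atLeastLessThan_Suc)
      \<comment> \<open>If \<open>t < h\<close>, the term at \<open>0\<close> keeps its value;
        otherwise it moves from \<open>h\<close> to \<open>Suc h\<close>, and the new term at
        \<open>k = h\<close> fills the gap.\<close>
      also have "\<dots> = (g c (min h (Suc t)) + (\<Sum>k=1..<h. ?F k)) +
          (if t < h then g (Suc c) t else g c (Suc h))"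
      proof (cases "t < h")
        case True
        then have "min (Suc h) (Suc t) = Suc t" "min h (Suc t) = Suc t" by auto
        with True show ?thesis by (simp add: add.assoc)
      next
        case False
        then have "min (Suc h) (Suc t) = Suc h" "min h (Suc t) = h" by auto
        with False show ?thesis by (simp add: ac_simps)
      qed
      also have "\<dots> = ?L h + (if t < h then g (Suc c) t else g c (Suc h))"
        using False by (subst L) auto
      finally show ?thesis using Suc by simp
    qed simp
  qed simp
qed

lemma joint_distribution_greater:
  fixes g :: "nat \<Rightarrow> nat \<Rightarrow> 'a::comm_monoid_add"
  assumes "finite S"
  shows "(\<Sum>w\<in>permutations_of_set S. g (match_count (>) m w) (card (sorted_top (>) m w))) =
    distr (card S) (card {b \<in> S. m < b}) g"
proof (rule joint_distribution[where next_top = "\<lambda>h t k. if k = 0 then min h (Suc t) else k"])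
  fix m a :: nat and w
  assume *: "m < a" "distinct (a # w)" "sorted_wrt (>) (filter (\<lambda>x. a < x) w)"
  \<comment> \<open>Hence \<open>Suc t\<close> does not exceed the cap in
    \<open>next_top\<close>.\<close>
  have "card (sorted_top (>) m w) \<le> card {b \<in> set w. m < b}"
    by (rule card_mono) (auto simp: sorted_top_def)
  moreover have "card {b \<in> set w. a < b} = 0 \<longleftrightarrow> {b \<in> set w. a < b} = {}"
    by (rule card_0_eq) simp
  ultimately show "card (sorted_top (>) m (a # w)) =
    (if card {b \<in> set w. a < b} = 0
     then min (Suc (card {b \<in> set w. m < b})) (Suc (card (sorted_top (>) m w)))
     else card {b \<in> set w. a < b})"
    using card_sorted_top_Cons_greater[of m a w] * by (simp only: min_def Suc_le_mono) auto
qed (use assms sum_rotate in auto)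

section \<open>Matches of the two patterns\<close>

text \<open>\<open>m\<close> acts as an extra letter in front of \<open>w\<close>; passing to the
  tail absorbs the first letter into \<open>min m a\<close>.\<close>

lemma match_count_eq_card:
  "match_count Q m w = card {l. l < length w \<and> (m < w ! l \<or> (\<exists>i<l. w ! i < w ! l)) \<and>
     \<not> sorted_wrt Q (filter (\<lambda>x. w ! l < x) (drop (Suc l) w))}"
proof (induction w arbitrary: m)
  case (Cons a w)
  let ?P = "\<lambda>m w l. (m < w ! l \<or> (\<exists>i<l. w ! i < w ! l)) \<and>
     \<not> sorted_wrt Q (filter (\<lambda>x. w ! l < x) (drop (Suc l) w))"
  have shift: "?P m (a # w) (Suc l) \<longleftrightarrow> ?P (min m a) w l" for l
    by (auto simp: less_Suc_eq_0_disj min_less_iff_disj)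
  have "{l. l < length (a # w) \<and> ?P m (a # w) l} =
    (if ?P m (a # w) 0 then {0} else {}) \<union> Suc ` {l. l < length w \<and> ?P (min m a) w l}"
    (is "?A = ?B")
  proof (rule set_eqI)
    fix l show "l \<in> ?A \<longleftrightarrow> l \<in> ?B"
    proof (cases l)
      case (Suc k)
      show ?thesis unfolding Suc mem_Collect_eq shift by auto
    qed auto
  qed
  then have "card {l. l < length (a # w) \<and> ?P m (a # w) l} =
    (if ?P m (a # w) 0 then 1 else 0) + card {l. l < length w \<and> ?P (min m a) w l}"
    by (simp only:) (subst card_Un_disjoint, auto simp: card_image)
  then show ?case
    using Cons.IH[of "min m a"] by (auto simp: min_def)
qed simp

text \<open>Contrapositive of the monotonicity of ranks; three comparisons of consecutive ranks then
  order the letters of a pattern of length four.\<close>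

lemma red_less:
  assumes "red w ! i < red w ! j" "i < length w" "j < length w"
  shows "w ! i < w ! j"
proof (rule ccontr)
  assume "\<not> w ! i < w ! j"
  then have "card {b \<in> set w. b \<le> w ! j} \<le> card {b \<in> set w. b \<le> w ! i}"
    by (intro card_mono) auto
  with assms show False by (simp add: red_def)
qed

lemma red_1234_iff: "red [a, b, c, d] = [1, 2, 3, 4] \<longleftrightarrow> a < b \<and> b < c \<and> c < d"
proof
  assume "red [a, b, c, d] = [1, 2, 3, 4]"
  then show "a < b \<and> b < c \<and> c < d"
    using red_less[of "[a, b, c, d]" 0 1] red_less[of "[a, b, c, d]" 1 2]
      red_less[of "[a, b, c, d]" 2 3] by (simp add: numeral_2_eq_2 numeral_3_eq_3)
next
  assume *: "a < b \<and> b < c \<and> c < d"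
  then have "{x \<in> {a, b, c, d}. x \<le> a} = {a}" "{x \<in> {a, b, c, d}. x \<le> b} = {a, b}"
    "{x \<in> {a, b, c, d}. x \<le> c} = {a, b, c}" "{x \<in> {a, b, c, d}. x \<le> d} = {a, b, c, d}"
    by auto
  with * show "red [a, b, c, d] = [1, 2, 3, 4]"
    unfolding red_def by (simp only: list.map list.set) auto
qed

lemma red_1243_iff: "red [a, b, c, d] = [1, 2, 4, 3] \<longleftrightarrow> a < b \<and> b < d \<and> d < c"
proof
  assume "red [a, b, c, d] = [1, 2, 4, 3]"
  then show "a < b \<and> b < d \<and> d < c"
    using red_less[of "[a, b, c, d]" 0 1] red_less[of "[a, b, c, d]" 1 3]
      red_less[of "[a, b, c, d]" 3 2] by (simp add: numeral_2_eq_2 numeral_3_eq_3)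
next
  assume *: "a < b \<and> b < d \<and> d < c"
  then have "{x \<in> {a, b, c, d}. x \<le> a} = {a}" "{x \<in> {a, b, c, d}. x \<le> b} = {a, b}"
    "{x \<in> {a, b, c, d}. x \<le> d} = {a, b, d}" "{x \<in> {a, b, c, d}. x \<le> c} = {a, b, c, d}"
    by auto
  with * show "red [a, b, c, d] = [1, 2, 4, 3]"
    unfolding red_def by (simp only: list.map list.set) auto
qed

lemma match_at_length_4:
  assumes "length p = 4"
  shows "match_at (Marked_Pattern p 2) w (Suc l) \<longleftrightarrow>
    (\<exists>i j k. i < l \<and> l < j \<and> j < k \<and> k < length w \<and> red [w ! i, w ! l, w ! j, w ! k] = p)"
    (is "?L \<longleftrightarrow> ?R")
proof
  assume ?L
  then obtain "is" where len: "length is = 4" and "set is \<subseteq> {1..length w}" "sorted_wrt (<) is"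
    "letter is 2 = Suc l" "red (map (letter w) is) = p"
    using assms by (auto simp: match_at_def)
  moreover obtain a b c d where "is = [a, b, c, d]"
    using len by (auto simp: numeral_eq_Suc length_Suc_conv)
  \<comment> \<open>The entries of \<open>is\<close> count positions from 1, hence the shift by one;
    the marked entry \<open>b\<close> is \<open>Suc l\<close>.\<close>
  ultimately show ?R
    by (intro exI[of _ "a - 1"] exI[of _ "c - 1"] exI[of _ "d - 1"]) (auto simp: letter_def)
next
  assume ?R
  then obtain i j k where "i < l" "l < j" "j < k" "k < length w"
    "red [w ! i, w ! l, w ! j, w ! k] = p" by blast
  then show ?L
    unfolding match_at_def
    by (intro exI[of _ "[Suc i, Suc l, Suc j, Suc k]"]) (use assms in \<open>auto simp: letter_def\<close>)
qed

lemma sorted_wrt_filter_drop_iff: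
  "sorted_wrt Q (filter P (drop (Suc l) w)) \<longleftrightarrow>
    (\<forall>j k. l < j \<longrightarrow> j < k \<longrightarrow> k < length w \<longrightarrow> P (w ! j) \<longrightarrow> P (w ! k) \<longrightarrow> Q (w ! j) (w ! k))"
    (is "?L \<longleftrightarrow> ?R")
proof
  assume ?L
  show ?R
  proof (intro allI impI)
    fix j k assume "l < j" "j < k" "k < length w" "P (w ! j)" "P (w ! k)"
    then show "Q (w ! j) (w ! k)"
      using \<open>?L\<close>[unfolded sorted_wrt_filter_iff, unfolded sorted_wrt_iff_nth_less,
        rule_format, of "j - Suc l" "k - Suc l"] by simp
  qed
next
  assume ?R
  then show ?L
    unfolding sorted_wrt_filter_iff by (auto simp: sorted_wrt_iff_nth_less)
qed

text \<open>In \<open>red_iff\<close> the letter \<open>a\<close> occurs only in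
  \<open>a < b\<close>, so the smaller letter and the pair behind the marked one can be chosen
  independently. As an upper bound, \<open>m\<close> is never the smaller letter.\<close>

lemma pmp_eq_match_count:
  assumes "length p = 4" "distinct w" "\<forall>x\<in>set w. x \<le> m"
    and red_iff: "\<And>a b c d. c \<noteq> d \<Longrightarrow>
      red [a, b, c, d] = p \<longleftrightarrow> a < b \<and> b < c \<and> b < d \<and> \<not> Q c d"
  shows "pmp (Marked_Pattern p 2) w = match_count Q m w"
proof -
  have match: "match_at (Marked_Pattern p 2) w (Suc l) \<longleftrightarrow> (m < w ! l \<or> (\<exists>i<l. w ! i < w ! l)) \<and>
      \<not> sorted_wrt Q (filter (\<lambda>x. w ! l < x) (drop (Suc l) w))" if "l < length w" for l
  proof -
    have "\<not> m < w ! l" using assms(3) that by (simp add: not_less)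
    moreover have "w ! j \<noteq> w ! k" if "j < k" "k < length w" for j k
      using that assms(2) by (simp add: nth_eq_iff_index_eq)
    ultimately show ?thesis
      unfolding match_at_length_4[OF assms(1)] sorted_wrt_filter_drop_iff
      using red_iff by (smt (verit))
  qed
  have "{l \<in> {1..length w}. match_at (Marked_Pattern p 2) w l} =
    Suc ` {l. l < length w \<and> match_at (Marked_Pattern p 2) w (Suc l)}"
    by (auto simp: image_iff Suc_le_eq gr0_conv_Suc)
  also have "{l. l < length w \<and> match_at (Marked_Pattern p 2) w (Suc l)} =
    {l. l < length w \<and> (m < w ! l \<or> (\<exists>i<l. w ! i < w ! l)) \<and>
      \<not> sorted_wrt Q (filter (\<lambda>x. w ! l < x) (drop (Suc l) w))}"
    using match by blast
  finally show ?thesis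
    unfolding pmp_def match_count_eq_card by (simp add: card_image)
qed

text \<open>The pair playing \<open>34\<close> exists exactly when the larger letters are not
  decreasing, hence \<open>>\<close>. The test function forgets \<open>t\<close>, leaving the
  generating polynomial of the match count.\<close>

lemma pmp_poly_1234: "pmp_poly (Marked_Pattern [1, 2, 3, 4] 2) n =
    distr n (card {b \<in> {1..n}. n < b}) (\<lambda>c t. monom 1 c)"
proof -
  have "pmp (Marked_Pattern [1, 2, 3, 4] 2) w = match_count (>) n w"
    if "w \<in> permutations_of_set {1..n}" for w
  proof (rule pmp_eq_match_count)
    show "distinct w" "\<forall>x\<in>set w. x \<le> n"
      using that by (simp_all add: permutations_of_set_def)
    show "red [a, b, c, d] = [1, 2, 3, 4] \<longleftrightarrow> a < b \<and> b < c \<and> b < d \<and> \<not> c > d" if "c \<noteq> d" for a b c d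
      unfolding red_1234_iff using that by linarith
  qed simp
  then have "pmp_poly (Marked_Pattern [1, 2, 3, 4] 2) n =
      (\<Sum>w\<in>permutations_of_set {1..n}. monom 1 (match_count (>) n w))"
    unfolding pmp_poly_def by (intro sum.cong) auto
  also have "\<dots> = distr n (card {b \<in> {1..n}. n < b}) (\<lambda>c t. monom 1 c)"
    using joint_distribution_greater[of "{1..n}" "\<lambda>c t. monom 1 c" n] by simp
  finally show ?thesis .
qed

lemma pmp_poly_1243: "pmp_poly (Marked_Pattern [1, 2, 4, 3] 2) n =
    distr n (card {b \<in> {1..n}. n < b}) (\<lambda>c t. monom 1 c)"
proof -
  have "pmp (Marked_Pattern [1, 2, 4, 3] 2) w = match_count (<) n w"
    if "w \<in> permutations_of_set {1..n}" for w
  proof (rule pmp_eq_match_count)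
    show "distinct w" "\<forall>x\<in>set w. x \<le> n"
      using that by (simp_all add: permutations_of_set_def)
    show "red [a, b, c, d] = [1, 2, 4, 3] \<longleftrightarrow> a < b \<and> b < c \<and> b < d \<and> \<not> c < d" if "c \<noteq> d" for a b c d
      unfolding red_1243_iff using that by linarith
  qed simp
  then have "pmp_poly (Marked_Pattern [1, 2, 4, 3] 2) n =
      (\<Sum>w\<in>permutations_of_set {1..n}. monom 1 (match_count (<) n w))"
    unfolding pmp_poly_def by (intro sum.cong) auto
  also have "\<dots> = distr n (card {b \<in> {1..n}. n < b}) (\<lambda>c t. monom 1 c)"
    using joint_distribution_less[of "{1..n}" "\<lambda>c t. monom 1 c" n] by simp
  finally show ?thesis .
qed

theorem theorem7:
  shows "pmp_Wilf_equivalent (Marked_Pattern [1, 2, 3, 4] 2) (Marked_Pattern [1, 2, 4, 3] 2)"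
proof -
  have "set [1, 2, 3, 4] = {1..4::nat}" "set [1, 2, 4, 3] = {1..4::nat}" by auto
  then have "is_marked_pattern (Marked_Pattern [1, 2, 3, 4] 2)"
    "is_marked_pattern (Marked_Pattern [1, 2, 4, 3] 2)"
    unfolding is_marked_pattern_def permutations_of_set_def by simp_all
  then show ?thesis
    unfolding pmp_Wilf_equivalent_def pmp_poly_1234 pmp_poly_1243 by simp
qed

end
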